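(* Let $\Omega,U,H,\phi,r$ be as in the context. Assume: (1) for each $R>0$ there is a constant $C_R$ with $|H(x,p)-H(y,p)|\le C_R|x-y|$ and $|H(x,p)-H(x,q)|\le C_R|p-q|$ for all $x,y\in\overline U$ and $p,q\in\mathbb{R}^n$ with $|p|,|q|\le R$; (2) $\lim_{|p|\to\infty}\min_{x\in\overline U}H(x,p)=+\infty$; (3) $p\mapsto H(x,p)$ is convex for each $x\in\overline U$; (4) $\Omega$ is star-shaped with respect to the origin and there is $\kappa>0$ such that $\mathrm{dist}(x,\overline\Omega)\ge\kappa s$ for all $s>0$ and all $x\in(1+s)\partial\Omega$. If $$\lim_{\lambda\to0^+}\frac{r(\lambda)}{\phi(\lambda)}=0,$$ then both families $$\Big\{u_\lambda+\frac{c(0)}{\phi(\lambda)}\Big\}_{\lambda>0}\qquad\text{and}\qquad\Big\{u_\lambda+\frac{c(\lambda)}{\phi(\lambda)}\Big\}_{\lambda>0}$$ converge to $u^0$ locally uniformly in $\Omega$ as $\lambda\to0^+$.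
   Context: $\Omega\subset\mathbb{R}^n$ is open, bounded, connected, with $0\in\Omega$. $U=B(0,R_0)$ is an open ball with $2\Omega\subseteq U$, and $H:\overline U\times\mathbb{R}^n\to\mathbb{R}$ is continuous. $\phi:(0,\infty)\to(0,\infty)$ is continuous and nondecreasing, $r:(0,\infty)\to\mathbb{R}$ is continuous, and $\phi(\lambda)\to0$, $r(\lambda)\to0$ as $\lambda\to0^+$. Set $\Omega_\lambda=(1+r(\lambda))\Omega$; only small $\lambda>0$ matter, so that $1+r(\lambda)>0$ and $\overline{\Omega_\lambda}\subset \overline U$. State-constraint solutions: for an open set $D\subset U$ and $\delta\ge0$, a function $v\in C(\overline D)$ is a (viscosity) state-constraint solution of $\delta v+H(x,Dv)=a$ in $D$ (with $a\in\mathbb{R}$) if (i) it is a viscosity subsolution in $D$: whenever $\varphi\in C^1(D)$ and $v-\varphi$ has a local maximum at $x\in D$, then $\delta v(x)+H(x,D\varphi(x))\le a$; and (ii) it is a viscosity supersolution on $\overline D$: whenever $\varphi\in C^1(\overline D)$ and $v-\varphi$ has a local minimum relative to $\overline D$ at $x\in\overline D$, then $\delta v(x)+H(x,D\varphi(x))\ge a$. $u_\lambda\in C(\overline{\Omega_\lambda})$ is the unique state-constraint solution of $\phi(\lambda)u_\lambda+H(x,Du_\lambda)=0$ in $\Omega_\lambda$. The additive eigenvalue of $H$ in an open set $D$ is $\inf\{c\in\mathbb{R}: H(x,Dv)\le c \text{ has a viscosity subsolution in } D\}$. $c(0)$ denotes the additive eigenvalue of $H$ in $\Omega$, and $c(\lambda)$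 (for $\lambda>0$) that of $H$ in $\Omega_\lambda$. $u^0\in C(\overline\Omega)$ is the limiting solution of the vanishing discount problem on the fixed domain $\Omega$: $u^0=\lim_{\delta\to0^+}(v_\delta+c(0)/\delta)$ uniformly on $\overline\Omega$, where $v_\delta$ is the unique state-constraint solution of $\delta v_\delta+H(x,Dv_\delta)=0$ in $\Omega$ (this limit is known to exist). *)

theory Defs
  imports "HOL-Analysis.Analysis"
begin

definition C1_gradient_on :: "'a::euclidean_space set \<Rightarrow> ('a \<Rightarrow> real) \<Rightarrow> ('a \<Rightarrow> 'a) \<Rightarrow> bool"
  where "C1_gradient_on W \<psi> g \<longleftrightarrow> (\<forall>x\<in>W. GDERIV \<psi> x :> g x) \<and> continuous_on W g"

definition local_max_on :: "'a::metric_space set \<Rightarrow> ('a \<Rightarrow> real) \<Rightarrow> 'a \<Rightarrow> bool"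
  where "local_max_on S f x \<longleftrightarrow> x \<in> S \<and> (\<exists>e>0. \<forall>y \<in> S \<inter> ball x e. f y \<le> f x)"

definition local_min_on :: "'a::metric_space set \<Rightarrow> ('a \<Rightarrow> real) \<Rightarrow> 'a \<Rightarrow> bool"
  where "local_min_on S f x \<longleftrightarrow> x \<in> S \<and> (\<exists>e>0. \<forall>y \<in> S \<inter> ball x e. f x \<le> f y)"

text \<open>The parameters \<open>\<delta> H a D\<close> stand for the equation \<open>\<delta> v + H(x, Dv) = a\<close> in the open set \<open>D\<close>.\<close>

definition viscosity_subsolution ::
    "real \<Rightarrow> ('a::euclidean_space \<Rightarrow> 'a \<Rightarrow> real) \<Rightarrow> real \<Rightarrow> 'a set \<Rightarrow> ('a \<Rightarrow> real) \<Rightarrow> bool"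
  where "viscosity_subsolution \<delta> H a D v \<longleftrightarrow>
    continuous_on D v \<and>
    (\<forall>\<psi> g x. C1_gradient_on D \<psi> g \<and> local_max_on D (\<lambda>y. v y - \<psi> y) x
       \<longrightarrow> \<delta> * v x + H x (g x) \<le> a)"

text \<open>
  A test function in \<open>C\<^sup>1\<close> of the closure of \<open>D\<close> is one that is \<open>C\<^sup>1\<close> on some open
  neighbourhood \<open>W\<close> of that closure, so that its gradient makes sense at boundary points.
\<close>

definition viscosity_supersolution_closure ::
    "real \<Rightarrow> ('a::euclidean_space \<Rightarrow> 'a \<Rightarrow> real) \<Rightarrow> real \<Rightarrow> 'a set \<Rightarrow> ('a \<Rightarrow> real) \<Rightarrow> bool"
  where "viscosity_supersolution_closure \<delta> H a D v \<longleftrightarrow>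
    continuous_on (closure D) v \<and>
    (\<forall>W \<psi> g x. open W \<and> closure D \<subseteq> W \<and> C1_gradient_on W \<psi> g \<and>
        local_min_on (closure D) (\<lambda>y. v y - \<psi> y) x
       \<longrightarrow> a \<le> \<delta> * v x + H x (g x))"

definition state_constraint_solution ::
    "real \<Rightarrow> ('a::euclidean_space \<Rightarrow> 'a \<Rightarrow> real) \<Rightarrow> real \<Rightarrow> 'a set \<Rightarrow> ('a \<Rightarrow> real) \<Rightarrow> bool"
  where "state_constraint_solution \<delta> H a D v \<longleftrightarrow>
    continuous_on (closure D) v \<and>
    viscosity_subsolution \<delta> H a D v \<and> viscosity_supersolution_closure \<delta> H a D v"

definition additive_eigenvalue ::
    "('a::euclidean_space \<Rightarrow> 'a \<Rightarrow> real) \<Rightarrow> 'a set \<Rightarrow> real"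
  where "additive_eigenvalue H D = Inf {c. \<exists>v. viscosity_subsolution 0 H c D v}"

end

theory Submission
  imports Defs
begin

text \<open>
  Let \<open>u\<close> be a solution on \<open>a\<Omega>\<close> and \<open>w\<close> one on \<open>b\<Omega>\<close>, with the same discount \<open>\<delta>\<close>. Doubling
  variables with the penalty \<open>|\<sigma>x - y|\<^sup>2/(2\<epsilon>)\<close>, where \<open>\<sigma> = (1 + t)b/a\<close>, the condition on
  \<open>\<kappa>\<close> keeps the maximizing \<open>x\<close> in the interior, so that the subsolution test is
  available there, while the supersolution test holds up to the boundary. The two test gradients are
  \<open>\<sigma>p\<close> and \<open>p\<close>, and coercivity bounds them through the subsolution inequality, so
  \<open>\<delta>(u(az) - w(bz)) \<le> L|b/a - 1|\<close> as \<open>\<epsilon>, t \<rightarrow> 0\<close>. With \<open>(a,b)\<close> equal to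
  \<open>(1 + r, 1)\<close> and \<open>(1, 1 + r)\<close> this compares the solution on the scaled domain with the one on \<open>\<Omega>\<close>
  up to \<open>O(|r|/\<phi>) \<rightarrow> 0\<close>. Rescaling subsolutions gives in the same way \<open>|c(\<lambda>) - c(0)| = O(|r|)\<close>.
\<close>

section \<open>Doubling of variables with a quadratic penalty\<close>

lemma C1_gradient_on_quadratic:
  fixes y :: "'a::euclidean_space"
  shows "C1_gradient_on W (\<lambda>x. c * (norm (k *\<^sub>R x - y))\<^sup>2) (\<lambda>x. (2 * c * k) *\<^sub>R (k *\<^sub>R x - y))"
  unfolding C1_gradient_on_def gderiv_def power2_norm_eq_inner
  by (auto intro!: derivative_eq_intros continuous_intros simp: fun_eq_iff inner_commute algebra_simps)

text \<open>Subtracting the two tests leaves \<open>H y p - H x (\<sigma> *\<^sub>R p)\<close>,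
  where \<open>x - y\<close> and \<open>\<sigma> *\<^sub>R p - p\<close> are of order
  \<open>\<bar>\<sigma> - 1\<bar>\<close> up to a term linear in the penalty parameter. The compared
  points satisfy \<open>z = \<sigma> *\<^sub>R z'\<close>, so their penalty vanishes; the geometry
  of the domains enters through \<open>sep\<close>. The radius \<open>2 * R\<close> pays for
  \<open>\<sigma> \<ge> 1/2\<close>: a bound \<open>R\<close> on \<open>\<sigma> *\<^sub>R p\<close>
  gives only \<open>2 * R\<close> for \<open>p\<close>.\<close>

lemma doubling_estimate:
  fixes H :: "'a::euclidean_space \<Rightarrow> 'a \<Rightarrow> real"
  assumes D: "bounded D" and E: "bounded E"
    and sub: "viscosity_subsolution \<delta> H 0 D u" and cu: "continuous_on (closure D) u"
    and super: "viscosity_supersolution_closure \<delta> H 0 E w"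
    and pos: "\<delta> \<ge> 0" "\<sigma> \<ge> 1/2" "d > 0" "C \<ge> 0" "R \<ge> 0"
    and sep: "\<And>x y. x \<in> closure D - D \<Longrightarrow> y \<in> closure E \<Longrightarrow> d \<le> norm (\<sigma> *\<^sub>R x - y)"
    and R: "\<And>x p. x \<in> D \<Longrightarrow> H x p \<le> - \<delta> * u x \<Longrightarrow> norm p \<le> R"
    and C: "\<And>x y p q. x \<in> D \<Longrightarrow> y \<in> closure E \<Longrightarrow> norm p \<le> 2 * R \<Longrightarrow> norm q \<le> 2 * R \<Longrightarrow>
        H y q - H x p \<le> C * (norm (x - y) + norm (p - q))"
    and B: "\<And>x. x \<in> D \<Longrightarrow> norm x \<le> B"
    and z: "z \<in> closure E" "z' \<in> closure D" "z = \<sigma> *\<^sub>R z'"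
  shows "\<delta> * (u z' - w z) \<le> C * (\<bar>\<sigma> - 1\<bar> * (B + 2 * R))"
proof -
  have cw: "continuous_on (closure E) w"
    using super by (simp add: viscosity_supersolution_closure_def)
  have cD: "compact (closure D)" and cE: "compact (closure E)" using D E by auto
  obtain Bu where Bu: "\<And>x. x \<in> closure D \<Longrightarrow> \<bar>u x\<bar> \<le> Bu"
    using compact_imp_bounded[OF compact_continuous_image[OF cu cD]] by (auto simp: bounded_iff)
  obtain Bw where Bw: "\<And>x. x \<in> closure E \<Longrightarrow> \<bar>w x\<bar> \<le> Bw"
    using compact_imp_bounded[OF compact_continuous_image[OF cw cE]] by (auto simp: bounded_iff)
  \<comment> \<open>Comparison with the penalty-free pair \<open>(z', z)\<close> bounds the penalty
    at a maximizer by \<open>2 * Bu + 2 * Bw\<close>; the extra 1 makes \<open>M\<close> positive,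
    so that it may be divided by.\<close>
  define M where "M = 2 * Bu + 2 * Bw + 1"
  have M: "M > 0" using Bu[OF z(2)] Bw[OF z(1)] by (simp add: M_def)
  \<comment> \<open>The smallness of \<open>e\<close> turns the penalty bound \<open>M\<close> into
    \<open>norm (\<sigma> *\<^sub>R x - y) < d\<close>, which by \<open>sep\<close> forces
    \<open>x \<in> D\<close>.\<close>
  have est: "\<delta> * (u z' - w z) \<le> C * (\<bar>\<sigma> - 1\<bar> * (B + 2 * R)) + C * (2 * R) * e"
    if e: "0 < e" "e < d\<^sup>2 / (2 * M)" for e
  proof -
    define F where "F = (\<lambda>(x, y). u x - w y - (norm (\<sigma> *\<^sub>R x - y))\<^sup>2 / (2 * e))"
    have "continuous_on (closure D \<times> closure E) F"
      unfolding F_def split_beta using e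
      by (auto intro!: continuous_intros continuous_on_compose2[OF cu] continuous_on_compose2[OF cw])
    then obtain xy where xy: "xy \<in> closure D \<times> closure E"
        "\<And>q. q \<in> closure D \<times> closure E \<Longrightarrow> F q \<le> F xy"
      using continuous_attains_sup[of "closure D \<times> closure E" F] z cD cE compact_Times by blast
    obtain x y where [simp]: "xy = (x, y)" by (cases xy)
    have x: "x \<in> closure D" and y: "y \<in> closure E" using xy(1) by auto
    have mx: "u x' - w y' - (norm (\<sigma> *\<^sub>R x' - y'))\<^sup>2 / (2 * e)
        \<le> u x - w y - (norm (\<sigma> *\<^sub>R x - y))\<^sup>2 / (2 * e)"
      if "x' \<in> closure D" "y' \<in> closure E" for x' y'
      using xy(2)[of "(x', y')"] that by (simp add: F_def)
    have zz: "u z' - w z \<le> u x - w y - (norm (\<sigma> *\<^sub>R x - y))\<^sup>2 / (2 * e)"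
      using mx[OF z(2) z(1)] z(3) by simp
    have "(norm (\<sigma> *\<^sub>R x - y))\<^sup>2 / (2 * e) \<le> M"
      using zz Bu[OF z(2)] Bw[OF z(1)] Bu[OF x] Bw[OF y] by (simp add: M_def)
    hence "(norm (\<sigma> *\<^sub>R x - y))\<^sup>2 \<le> M * (2 * e)" using e by (simp add: field_simps)
    also have "\<dots> < d\<^sup>2" using e M by (simp add: field_simps)
    finally have "norm (\<sigma> *\<^sub>R x - y) < d" using pos(3) by (simp add: power_less_imp_less_base)
    hence xD: "x \<in> D" using sep[of x y] x y by force
    \<comment> \<open>The penalty has gradient \<open>\<sigma> *\<^sub>R p\<close> in
      \<open>x\<close> and \<open>- p\<close> in \<open>y\<close>. In the test of \<open>w\<close>
      it enters with the opposite sign, so the supersolution sees \<open>p\<close>.\<close>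
    define p where "p = (1 / e) *\<^sub>R (\<sigma> *\<^sub>R x - y)"
    have "local_max_on D (\<lambda>x'. u x' - (1 / (2 * e)) * (norm (\<sigma> *\<^sub>R x' - y))\<^sup>2) x"
      unfolding local_max_on_def
      using xD mx[OF _ y] closure_subset[of D] by (auto intro!: exI[of _ 1])
    hence "\<delta> * u x + H x ((2 * (1 / (2 * e)) * \<sigma>) *\<^sub>R (\<sigma> *\<^sub>R x - y)) \<le> 0"
      using sub C1_gradient_on_quadratic[of D "1 / (2 * e)" \<sigma> y]
      unfolding viscosity_subsolution_def by blast
    hence 1: "\<delta> * u x + H x (\<sigma> *\<^sub>R p) \<le> 0" using e by (simp add: p_def)
    have "local_min_on (closure E) (\<lambda>y'. w y' - (- (1 / (2 * e))) * (norm (1 *\<^sub>R y' - \<sigma> *\<^sub>R x))\<^sup>2) y"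
      unfolding local_min_on_def
      using y mx[OF x] by (auto intro!: exI[of _ 1] simp: norm_minus_commute[of _ "\<sigma> *\<^sub>R x"] algebra_simps)
    hence "0 \<le> \<delta> * w y + H y ((2 * (- (1 / (2 * e))) * 1) *\<^sub>R (1 *\<^sub>R y - \<sigma> *\<^sub>R x))"
      using super C1_gradient_on_quadratic[of UNIV "- (1 / (2 * e))" 1 "\<sigma> *\<^sub>R x"]
      unfolding viscosity_supersolution_closure_def by blast
    moreover have "(2 * (- (1 / (2 * e))) * 1) *\<^sub>R (1 *\<^sub>R y - \<sigma> *\<^sub>R x) = p"
      by (simp add: p_def algebra_simps)
    ultimately have 2: "0 \<le> \<delta> * w y + H y p" by simp
    have sp: "norm (\<sigma> *\<^sub>R p) \<le> R" using R[OF xD, of "\<sigma> *\<^sub>R p"] 1 by linarith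
    have p: "norm p \<le> 2 * R"
    proof -
      have "(1/2) * norm p \<le> \<sigma> * norm p" by (rule mult_right_mono) (use pos in auto)
      thus ?thesis using sp pos by simp
    qed
    have xy': "norm (x - y) \<le> e * (2 * R) + \<bar>\<sigma> - 1\<bar> * B"
    proof -
      \<comment> \<open>This identity makes the distance small through the gradient bound:
        \<open>e *\<^sub>R p\<close> vanishes with \<open>e\<close>, and the rest is of order
        \<open>\<bar>\<sigma> - 1\<bar>\<close>.\<close>
      have "x - y = e *\<^sub>R p - (\<sigma> - 1) *\<^sub>R x" using e by (simp add: p_def algebra_simps)
      hence "norm (x - y) \<le> norm (e *\<^sub>R p) + norm ((\<sigma> - 1) *\<^sub>R x)" by (metis norm_triangle_ineq4)
      also have "\<dots> = e * norm p + \<bar>\<sigma> - 1\<bar> * norm x" using e by simp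
      also have "\<dots> \<le> e * (2 * R) + \<bar>\<sigma> - 1\<bar> * B"
        using p B[OF xD] e by (intro add_mono mult_left_mono) auto
      finally show ?thesis .
    qed
    have pq: "norm (\<sigma> *\<^sub>R p - p) \<le> \<bar>\<sigma> - 1\<bar> * (2 * R)"
    proof -
      have "\<sigma> *\<^sub>R p - p = (\<sigma> - 1) *\<^sub>R p" by (simp add: algebra_simps)
      thus ?thesis using p by (simp add: mult_left_mono)
    qed
    have "u z' - w z \<le> u x - w y"
    proof -
      have "0 \<le> (norm (\<sigma> *\<^sub>R x - y))\<^sup>2 / (2 * e)" using e by simp
      thus ?thesis using zz by linarith
    qed
    hence "\<delta> * (u z' - w z) \<le> \<delta> * (u x - w y)" using pos by (simp add: mult_left_mono)
    also have "\<dots> \<le> H y p - H x (\<sigma> *\<^sub>R p)" using 1 2 by (simp add: algebra_simps)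
    also have "\<dots> \<le> C * (norm (x - y) + norm (\<sigma> *\<^sub>R p - p))"
      using C[OF xD y, of "\<sigma> *\<^sub>R p" p] sp p pos by simp
    also have "\<dots> \<le> C * (e * (2 * R) + \<bar>\<sigma> - 1\<bar> * B + \<bar>\<sigma> - 1\<bar> * (2 * R))"
      using xy' pq pos by (intro mult_left_mono add_mono) auto
    also have "\<dots> = C * (\<bar>\<sigma> - 1\<bar> * (B + 2 * R)) + C * (2 * R) * e" by (simp add: algebra_simps)
    finally show ?thesis .
  qed
  have "((\<lambda>e. C * (\<bar>\<sigma> - 1\<bar> * (B + 2 * R)) + C * (2 * R) * e) \<longlongrightarrow>
      C * (\<bar>\<sigma> - 1\<bar> * (B + 2 * R)) + C * (2 * R) * 0) (at_right 0)"
    by (intro tendsto_intros)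
  moreover have "\<forall>\<^sub>F e in at_right 0. \<delta> * (u z' - w z) \<le> C * (\<bar>\<sigma> - 1\<bar> * (B + 2 * R)) + C * (2 * R) * e"
    unfolding eventually_at_right_field
    by (rule exI[of _ "d\<^sup>2 / (2 * M)"]) (use est M pos in auto)
  ultimately have "\<delta> * (u z' - w z) \<le> C * (\<bar>\<sigma> - 1\<bar> * (B + 2 * R)) + C * (2 * R) * 0"
    by (rule tendsto_lowerbound) simp
  thus ?thesis by simp
qed

section \<open>Rescaled subsolutions and bounds from simple test functions\<close>

text \<open>If \<open>\<psi>\<close> touches the rescaled function at \<open>k *\<^sub>R x\<close>,
  then \<open>\<psi>\<close> composed with the scaling touches \<open>v\<close> at \<open>x\<close>,
  and the chain rule multiplies the gradient by \<open>k\<close>. The hypothesis \<open>H\<close> is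
  exactly the exchange of inequalities this requires.\<close>

lemma viscosity_subsolution_rescale:
  fixes H :: "'a::euclidean_space \<Rightarrow> 'a \<Rightarrow> real"
  assumes v: "viscosity_subsolution 0 H c D v" and k: "k > 0"
    and H: "\<And>x p. x \<in> D \<Longrightarrow> H x (k *\<^sub>R p) \<le> c \<Longrightarrow> H (k *\<^sub>R x) p \<le> c'"
  shows "viscosity_subsolution 0 H c' ((*\<^sub>R) k ` D) (\<lambda>y. v ((1 / k) *\<^sub>R y))"
  unfolding viscosity_subsolution_def
proof (intro conjI allI impI; (elim conjE)?)
  have cv: "continuous_on D v" using v by (simp add: viscosity_subsolution_def)
  show "continuous_on ((*\<^sub>R) k ` D) (\<lambda>y. v ((1 / k) *\<^sub>R y))"
    using k by (auto intro!: continuous_on_compose2[OF cv] continuous_intros)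
next
  fix \<psi> g y
  assume g: "C1_gradient_on ((*\<^sub>R) k ` D) \<psi> g"
    and mx: "local_max_on ((*\<^sub>R) k ` D) (\<lambda>y. v ((1 / k) *\<^sub>R y) - \<psi> y) y"
  obtain x where x: "x \<in> D" "y = k *\<^sub>R x" using mx by (auto simp: local_max_on_def)
  have cg: "continuous_on ((*\<^sub>R) k ` D) g" using g by (simp add: C1_gradient_on_def)
  have C1: "C1_gradient_on D (\<lambda>x. \<psi> (k *\<^sub>R x)) (\<lambda>x. k *\<^sub>R g (k *\<^sub>R x))"
    unfolding C1_gradient_on_def
  proof (intro conjI ballI)
    fix x assume "x \<in> D"
    hence "(\<psi> has_derivative (\<lambda>h. inner h (g (k *\<^sub>R x)))) (at (k *\<^sub>R x))"
      using g by (simp add: C1_gradient_on_def gderiv_def)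
    moreover have "((\<lambda>x. k *\<^sub>R x) has_derivative (\<lambda>h. k *\<^sub>R h)) (at x)"
      by (auto intro!: derivative_eq_intros)
    ultimately have "((\<lambda>x. \<psi> (k *\<^sub>R x)) has_derivative (\<lambda>h. inner (k *\<^sub>R h) (g (k *\<^sub>R x)))) (at x)"
      using has_derivative_compose[of "\<lambda>x. k *\<^sub>R x" _ x UNIV \<psi>] by blast
    thus "GDERIV (\<lambda>x. \<psi> (k *\<^sub>R x)) x :> k *\<^sub>R g (k *\<^sub>R x)" by (simp add: gderiv_def)
  qed (auto intro!: continuous_intros continuous_on_compose2[OF cg])
  obtain e where e: "e > 0" "\<And>y'. y' \<in> (*\<^sub>R) k ` D \<inter> ball y e \<Longrightarrow>
      v ((1 / k) *\<^sub>R y') - \<psi> y' \<le> v ((1 / k) *\<^sub>R y) - \<psi> y"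
    using mx by (auto simp: local_max_on_def)
  have "v x' - \<psi> (k *\<^sub>R x') \<le> v x - \<psi> (k *\<^sub>R x)" if x': "x' \<in> D" "dist x x' < e / k" for x'
  proof -
    have "dist (k *\<^sub>R x) (k *\<^sub>R x') = k * dist x x'"
      using k by (simp add: dist_norm flip: scaleR_diff_right)
    hence "dist (k *\<^sub>R x) (k *\<^sub>R x') < e" using x'(2) k by (simp add: field_simps)
    thus ?thesis using e(2)[of "k *\<^sub>R x'"] x'(1) x k by simp
  qed
  hence "local_max_on D (\<lambda>x. v x - \<psi> (k *\<^sub>R x)) x"
    unfolding local_max_on_def using x e k by (auto intro!: exI[of _ "e / k"])
  hence "H x (k *\<^sub>R g (k *\<^sub>R x)) \<le> c"
    using v C1 unfolding viscosity_subsolution_def by fastforce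
  thus "0 * v ((1 / k) *\<^sub>R y) + H y (g y) \<le> c'" using H[OF x(1)] x(2) by simp
qed

text \<open>Every continuous function is touched from above by a steep paraboloid at some interior
  point, so at least one test takes place. This bounds the admissible levels from below, without
  which their infimum would carry no information.\<close>

lemma viscosity_subsolution_level_ge:
  fixes H :: "'a::euclidean_space \<Rightarrow> 'a \<Rightarrow> real"
  assumes v: "viscosity_subsolution 0 H c D v" and D: "open D" "D \<noteq> {}"
    and m: "\<And>x p. x \<in> D \<Longrightarrow> m \<le> H x p"
  shows "m \<le> c"
proof -
  obtain x0 where "x0 \<in> D" using D by auto
  then obtain \<rho> where \<rho>: "\<rho> > 0" "cball x0 \<rho> \<subseteq> D" using D open_contains_cball by metis
  have cv: "continuous_on (cball x0 \<rho>) v"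
    using v \<rho> continuous_on_subset by (auto simp: viscosity_subsolution_def)
  obtain Bv where Bv: "\<And>x. x \<in> cball x0 \<rho> \<Longrightarrow> \<bar>v x\<bar> \<le> Bv"
    using compact_imp_bounded[OF compact_continuous_image[OF cv compact_cball]] by (auto simp: bounded_iff simp del: mem_cball)
  \<comment> \<open>On the sphere of radius \<open>\<rho>\<close> the paraboloid takes the value
    \<open>2 * Bv + 1\<close>, more than the oscillation of \<open>v\<close> on the ball, so the
    maximum cannot lie there.\<close>
  define k where "k = (2 * Bv + 1) / \<rho>\<^sup>2"
  define F where "F = (\<lambda>x. v x - k * (norm (1 *\<^sub>R x - x0))\<^sup>2)"
  have "continuous_on (cball x0 \<rho>) F" unfolding F_def by (intro continuous_intros cv)
  then obtain x where x: "x \<in> cball x0 \<rho>" "\<And>y. y \<in> cball x0 \<rho> \<Longrightarrow> F y \<le> F x"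
    using continuous_attains_sup[of "cball x0 \<rho>" F] \<rho> by auto
  have "norm (x - x0) \<noteq> \<rho>"
  proof
    assume "norm (x - x0) = \<rho>"
    hence "F x = v x - (2 * Bv + 1)" using \<rho> by (simp add: F_def k_def)
    moreover have "F x0 = v x0" by (simp add: F_def)
    ultimately show False using x(2)[of x0] Bv[OF x(1)] Bv[of x0] \<rho> by simp
  qed
  hence xb: "x \<in> ball x0 \<rho>" using x(1) by (auto simp: dist_norm norm_minus_commute)
  then obtain e where e: "e > 0" "ball x e \<subseteq> ball x0 \<rho>" using open_contains_ball open_ball by metis
  have xD: "x \<in> D" using x(1) \<rho> by auto
  have "local_max_on D F x"
    unfolding local_max_on_def
    using xD e x(2) ball_subset_cball[of x0 \<rho>] by (auto intro!: exI[of _ e])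
  hence "0 * v x + H x ((2 * k * 1) *\<^sub>R (1 *\<^sub>R x - x0)) \<le> c"
    using v C1_gradient_on_quadratic[of D k 1 x0] unfolding viscosity_subsolution_def F_def by blast
  thus ?thesis using m[OF xD, of "(2 * k * 1) *\<^sub>R (1 *\<^sub>R x - x0)"] by simp
qed

text \<open>A test function touching a constant has zero gradient at the contact point. This makes
  the set of admissible levels nonempty and bounds the additive eigenvalue by
  \<open>M\<close>.\<close>

lemma viscosity_subsolution_const:
  fixes H :: "'a::euclidean_space \<Rightarrow> 'a \<Rightarrow> real"
  assumes D: "open D" and M: "\<And>x. x \<in> D \<Longrightarrow> H x 0 \<le> M"
  shows "viscosity_subsolution 0 H M D (\<lambda>_. 0)"
  unfolding viscosity_subsolution_def
proof (intro conjI allI impI; (elim conjE)?)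
  fix \<psi> g x
  assume g: "C1_gradient_on D \<psi> g" and mx: "local_max_on D (\<lambda>y. 0 - \<psi> y) x"
  obtain e where x: "x \<in> D" and e: "e > 0" "\<And>y. y \<in> D \<inter> ball x e \<Longrightarrow> \<psi> x \<le> \<psi> y"
    using mx by (auto simp: local_max_on_def)
  have dx: "(\<psi> has_derivative (\<lambda>h. inner h (g x))) (at x)"
    using g x by (simp add: C1_gradient_on_def gderiv_def)
  have "(\<lambda>h. inner h (g x)) = (\<lambda>h. 0)"
    by (rule differential_zero_maxmin[of x "D \<inter> ball x e"]) (use x e dx D in auto)
  hence "inner (g x) (g x) = 0" by meson
  thus "0 * 0 + H x (g x) \<le> M" using M[OF x] by simp
qed simp

text \<open>The zero function is a test function at a minimum point of \<open>w\<close>, which may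
  lie on the boundary because the supersolution condition holds on the closure. The resulting bound
  does not depend on the discount and feeds the gradient bound of the doubling argument.\<close>

lemma viscosity_supersolution_lower_bound:
  fixes H :: "'a::euclidean_space \<Rightarrow> 'a \<Rightarrow> real"
  assumes w: "viscosity_supersolution_closure \<delta> H 0 D w" and D: "bounded D" and pos: "\<delta> \<ge> 0"
    and M: "\<And>x. x \<in> closure D \<Longrightarrow> H x 0 \<le> M" and x: "x \<in> closure D"
  shows "- \<delta> * w x \<le> M"
proof -
  have cw: "continuous_on (closure D) w" and cD: "compact (closure D)"
    using w D by (auto simp: viscosity_supersolution_closure_def)
  have "closure D \<noteq> {}" using x by (metis empty_iff)
  from continuous_attains_inf[OF cD this cw]
  obtain y where y: "y \<in> closure D" "\<And>x. x \<in> closure D \<Longrightarrow> w y \<le> w x" by blast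
  have "local_min_on (closure D) (\<lambda>x. w x - 0 * (norm (1 *\<^sub>R x - 0))\<^sup>2) y"
    using y by (auto simp: local_min_on_def intro!: exI[of _ 1])
  hence "0 \<le> \<delta> * w y + H y ((2 * 0 * 1) *\<^sub>R (1 *\<^sub>R y - 0))"
    using w C1_gradient_on_quadratic[of UNIV 0 1 "0::'a"]
    unfolding viscosity_supersolution_closure_def by blast
  moreover have "\<delta> * w y \<le> \<delta> * w x" using y(2)[OF x] pos by (simp add: mult_left_mono)
  ultimately show ?thesis using M[OF y(1)] by simp
qed

section \<open>Consequences of coercivity on a compact set\<close>

lemma coercive_sublevel_bounded:
  fixes H :: "'b::topological_space \<Rightarrow> 'a::euclidean_space \<Rightarrow> real"
  assumes K: "compact K" and H: "continuous_on (K \<times> UNIV) (\<lambda>(x, p). H x p)"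
    and co: "filterlim (\<lambda>p. INF x\<in>K. H x p) at_top at_infinity"
  obtains R where "R > 0" "\<And>x p. x \<in> K \<Longrightarrow> H x p \<le> M \<Longrightarrow> norm p \<le> R"
proof -
  have "\<forall>\<^sub>F p in at_infinity. M + 1 \<le> (INF x\<in>K. H x p)"
    using co by (simp add: filterlim_at_top)
  then obtain b where b: "\<And>p. b \<le> norm p \<Longrightarrow> M + 1 \<le> (INF x\<in>K. H x p)"
    by (auto simp: eventually_at_infinity)
  have "norm p \<le> max b 1" if x: "x \<in> K" and le: "H x p \<le> M" for x p
  proof (rule ccontr)
    assume "\<not> norm p \<le> max b 1"
    hence "M + 1 \<le> (INF x\<in>K. H x p)" using b by simp
    \<comment> \<open>The infimum lies below its members only if the set is bounded below, which
      compactness of \<open>K\<close> guarantees.\<close>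
    also have "continuous_on K (\<lambda>x. H x p)"
      using continuous_on_compose2[OF H, of K "\<lambda>x. (x, p)"] by (simp add: continuous_on_Pair image_subset_iff)
    hence "bdd_below ((\<lambda>x. H x p) ` K)"
      using K compact_continuous_image compact_imp_bounded bounded_imp_bdd_below by metis
    hence "(INF x\<in>K. H x p) \<le> H x p" using x by (rule cINF_lower)
    finally show False using le by simp
  qed
  thus ?thesis using that[of "max b 1"] by auto
qed

lemma coercive_bounded_below:
  fixes H :: "'b::topological_space \<Rightarrow> 'a::euclidean_space \<Rightarrow> real"
  assumes K: "compact K" and H: "continuous_on (K \<times> UNIV) (\<lambda>(x, p). H x p)"
    and co: "filterlim (\<lambda>p. INF x\<in>K. H x p) at_top at_infinity"
  obtains m where "\<And>x p. x \<in> K \<Longrightarrow> m \<le> H x p"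
proof -
  obtain R where R: "R > 0" "\<And>x p. x \<in> K \<Longrightarrow> H x p \<le> 0 \<Longrightarrow> norm p \<le> R"
    using coercive_sublevel_bounded[OF assms] by metis
  have "continuous_on (K \<times> cball 0 R) (\<lambda>(x, p). H x p)"
    by (rule continuous_on_subset[OF H]) auto
  then have "bounded ((\<lambda>(x, p). H x p) ` (K \<times> cball 0 R))"
    using K by (intro compact_imp_bounded compact_continuous_image compact_Times) auto
  then obtain b where b: "\<And>x p. x \<in> K \<Longrightarrow> norm p \<le> R \<Longrightarrow> \<bar>H x p\<bar> \<le> b"
    by (fastforce simp: bounded_iff)
  \<comment> \<open>Either \<open>H x p\<close> is positive, or \<open>p\<close> lies in the ball of
    radius \<open>R\<close>, where compactness gives the bound \<open>b\<close>.\<close>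
  have "min (- b) 0 \<le> H x p" if "x \<in> K" for x p
    using R(2)[OF that, of p] b[OF that, of p] by linarith
  thus ?thesis using that by blast
qed

section \<open>Uniform estimates between scaled copies of a star-shaped domain\<close>

text \<open>Only the geometry and the Hamiltonian are fixed here, so constants obtained inside the
  locale cannot depend on the discount or on the perturbation of the domain.\<close>

locale star_shaped_hamiltonian =
  fixes \<Omega> U :: "'a::euclidean_space set"
    and R0 \<kappa> :: real
    and H :: "'a \<Rightarrow> 'a \<Rightarrow> real"
  assumes Omega: "open \<Omega>" "bounded \<Omega>" "0 \<in> \<Omega>"
    and U: "U = ball 0 R0" "(*\<^sub>R) 2 ` \<Omega> \<subseteq> U"
    and H_cont: "continuous_on (closure U \<times> UNIV) (\<lambda>(x, p). H x p)"
    and H_Lipschitz: "\<forall>R>0. \<exists>C. \<forall>x\<in>closure U. \<forall>y\<in>closure U. \<forall>p q. norm p \<le> R \<and> norm q \<le> R \<longrightarrow>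
      \<bar>H x p - H y p\<bar> \<le> C * norm (x - y) \<and> \<bar>H x p - H x q\<bar> \<le> C * norm (p - q)"
    and H_coercive: "filterlim (\<lambda>p. INF x\<in>closure U. H x p) at_top at_infinity"
    and star_shaped: "\<forall>x\<in>\<Omega>. closed_segment 0 x \<subseteq> \<Omega>"
    and kappa: "\<kappa> > 0"
      "\<forall>s>0. \<forall>x \<in> (*\<^sub>R) (1 + s) ` frontier \<Omega>. infdist x (closure \<Omega>) \<ge> \<kappa> * s"
begin

lemma scale_subset: "0 \<le> k \<Longrightarrow> k \<le> 1 \<Longrightarrow> (*\<^sub>R) k ` \<Omega> \<subseteq> \<Omega>"
  using star_shaped by (force simp: closed_segment_def)

lemma scale_subset_U:
  assumes "0 \<le> k" "k \<le> 2" shows "(*\<^sub>R) k ` \<Omega> \<subseteq> U"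
proof -
  have "(*\<^sub>R) k ` \<Omega> = (*\<^sub>R) 2 ` (*\<^sub>R) (k / 2) ` \<Omega>" by (simp add: image_image)
  also have "\<dots> \<subseteq> (*\<^sub>R) 2 ` \<Omega>" using assms by (intro image_mono scale_subset) auto
  finally show ?thesis using U by simp
qed

lemma scale_closure_mem:
  assumes "0 \<le> k" "k \<le> 1" "z \<in> closure \<Omega>" shows "k *\<^sub>R z \<in> closure \<Omega>"
  using closure_mono[OF scale_subset[OF assms(1,2)]] assms(3) by (auto simp flip: closure_scaleR)

text \<open>The Lipschitz constant is taken on radius \<open>2 * R\<close>, since rescaling by a
  factor of at least 1/2 can double a gradient of norm \<open>R\<close>. The difference is split at
  \<open>H y p\<close>.\<close>

lemma sublevel_constants:
  obtains R C where "R > 0" "C \<ge> 0" "\<And>x p. x \<in> closure U \<Longrightarrow> H x p \<le> M \<Longrightarrow> norm p \<le> R"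
    "\<And>x y p q. x \<in> closure U \<Longrightarrow> y \<in> closure U \<Longrightarrow> norm p \<le> 2 * R \<Longrightarrow> norm q \<le> 2 * R \<Longrightarrow>
        H y q - H x p \<le> C * (norm (x - y) + norm (p - q))"
proof -
  have cU: "compact (closure U)" using U by simp
  obtain R where R: "R > 0" "\<And>x p. x \<in> closure U \<Longrightarrow> H x p \<le> M \<Longrightarrow> norm p \<le> R"
    using coercive_sublevel_bounded[OF cU H_cont H_coercive] by metis
  have "2 * R > 0" using R by simp
  then obtain C where C: "\<forall>x\<in>closure U. \<forall>y\<in>closure U. \<forall>p q. norm p \<le> 2 * R \<and> norm q \<le> 2 * R \<longrightarrow>
      \<bar>H x p - H y p\<bar> \<le> C * norm (x - y) \<and> \<bar>H x p - H x q\<bar> \<le> C * norm (p - q)"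
    using H_Lipschitz by blast
  have "H y q - H x p \<le> \<bar>C\<bar> * (norm (x - y) + norm (p - q))"
    if "x \<in> closure U" "y \<in> closure U" "norm p \<le> 2 * R" "norm q \<le> 2 * R" for x y p q
  proof -
    have "\<bar>H x p - H y p\<bar> \<le> C * norm (x - y)" "\<bar>H y p - H y q\<bar> \<le> C * norm (p - q)"
      using C that by blast+
    moreover have "C * norm (x - y) \<le> \<bar>C\<bar> * norm (x - y)" "C * norm (p - q) \<le> \<bar>C\<bar> * norm (p - q)"
      by (auto intro!: mult_right_mono)
    ultimately show ?thesis by (simp add: distrib_left)
  qed
  thus ?thesis using that[of R "\<bar>C\<bar>"] R by simp
qed

lemma H_zero_bounded: obtains M where "\<And>x. x \<in> closure U \<Longrightarrow> H x 0 \<le> M"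
proof -
  have "continuous_on (closure U) (\<lambda>x. H x 0)"
    using continuous_on_compose2[OF H_cont, of "closure U" "\<lambda>x. (x, 0)"] by (simp add: continuous_on_Pair image_subset_iff)
  hence "bounded ((\<lambda>x. H x 0) ` closure U)"
    using U by (intro compact_imp_bounded compact_continuous_image) auto
  then obtain M where "\<And>x. x \<in> closure U \<Longrightarrow> \<bar>H x 0\<bar> \<le> M" by (auto simp: bounded_iff)
  thus ?thesis using that[of M] abs_le_D1 by blast
qed

text \<open>The ratio \<open>b / a\<close> alone maps boundary onto boundary and leaves no
  separation. The additional factor \<open>1 + t\<close> opens a gap proportional to
  \<open>\<kappa> * t\<close>, and is removed by letting \<open>t\<close> tend to 0. Scales up to 2
  keep both domains inside \<open>U\<close>, where one choice of \<open>R\<close> and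
  \<open>C\<close> serves all discounts and solutions.\<close>

lemma comparison_scaled_domains:
  obtains L where "L \<ge> 0"
    "\<And>\<delta> a b u w z. \<delta> > 0 \<Longrightarrow> 0 < a \<Longrightarrow> a \<le> 2 \<Longrightarrow> 0 < b \<Longrightarrow> b \<le> 2 \<Longrightarrow> b / a \<ge> 1/2 \<Longrightarrow>
      state_constraint_solution \<delta> H 0 ((*\<^sub>R) a ` \<Omega>) u \<Longrightarrow>
      state_constraint_solution \<delta> H 0 ((*\<^sub>R) b ` \<Omega>) w \<Longrightarrow> z \<in> closure \<Omega> \<Longrightarrow>
      \<delta> * (u (a *\<^sub>R z) - w (b *\<^sub>R z)) \<le> L * \<bar>b / a - 1\<bar>"
proof -
  obtain M where M: "\<And>x. x \<in> closure U \<Longrightarrow> H x 0 \<le> M" using H_zero_bounded by metis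
  obtain R C where RC: "R > 0" "C \<ge> 0" "\<And>x p. x \<in> closure U \<Longrightarrow> H x p \<le> M \<Longrightarrow> norm p \<le> R"
    "\<And>x y p q. x \<in> closure U \<Longrightarrow> y \<in> closure U \<Longrightarrow> norm p \<le> 2 * R \<Longrightarrow> norm q \<le> 2 * R \<Longrightarrow>
        H y q - H x p \<le> C * (norm (x - y) + norm (p - q))"
    using sublevel_constants[of M] by metis
  have "R0 > 0" using U Omega(3) by force
  have est: "\<delta> * (u (a *\<^sub>R z) - w (b *\<^sub>R z)) \<le> (C * (R0 + 2 * R)) * \<bar>b / a - 1\<bar>"
    if \<delta>: "\<delta> > 0" and ab: "0 < a" "a \<le> 2" "0 < b" "b \<le> 2" "b / a \<ge> 1/2"
      and u: "state_constraint_solution \<delta> H 0 ((*\<^sub>R) a ` \<Omega>) u"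
      and w: "state_constraint_solution \<delta> H 0 ((*\<^sub>R) b ` \<Omega>) w"
      and z: "z \<in> closure \<Omega>" for \<delta> a b u w z
  proof -
    let ?D = "(*\<^sub>R) a ` \<Omega>" and ?E = "(*\<^sub>R) b ` \<Omega>"
    have DU: "?D \<subseteq> U" "closure ?D \<subseteq> closure U" and EU: "closure ?E \<subseteq> closure U"
      using scale_subset_U[of a] scale_subset_U[of b] ab by (simp_all add: closure_mono)
    have bd: "bounded ?D" "bounded ?E" using Omega by (auto intro: bounded_scaling)
    have cu: "continuous_on (closure ?D) u" using u by (simp add: state_constraint_solution_def)
    \<comment> \<open>The doubling estimate for the factor \<open>(1 + t) * (b / a)\<close> pairs
      \<open>b *\<^sub>R z\<close> with this contracted point, which star-shapedness keeps in the
      closed domain.\<close>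
    have path: "a *\<^sub>R ((1 / (1 + t)) *\<^sub>R z) \<in> closure ?D" if "t > 0" for t
      unfolding closure_scaleR[symmetric]
      by (intro imageI scale_closure_mem) (use that z in auto)
    \<comment> \<open>The gap is \<open>b * (\<kappa> * t)\<close> because, once \<open>b\<close> is
      factored out, the separation is that between \<open>(1 + t) *\<^sub>R x'\<close> with
      \<open>x'\<close> in the frontier and a point of \<open>closure \<Omega>\<close>.\<close>
    have one: "\<delta> * (u (a *\<^sub>R ((1 / (1 + t)) *\<^sub>R z)) - w (b *\<^sub>R z))
        \<le> C * (\<bar>(1 + t) * (b / a) - 1\<bar> * (R0 + 2 * R))" if t: "t > 0" for t
    proof (rule doubling_estimate[where D = ?D and E = ?E and d = "b * (\<kappa> * t)"])
      show "bounded ?D" "bounded ?E" "continuous_on (closure ?D) u" by fact+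
      show "viscosity_subsolution \<delta> H 0 ?D u" "viscosity_supersolution_closure \<delta> H 0 ?E w"
        using u w by (auto simp: state_constraint_solution_def)
      have "1 * (1/2) \<le> (1 + t) * (b / a)" using ab t by (intro mult_mono) auto
      thus "1/2 \<le> (1 + t) * (b / a)" by simp
      show "b * (\<kappa> * t) > 0" using ab t kappa by simp
      fix x y assume x: "x \<in> closure ?D - ?D" and y: "y \<in> closure ?E"
      obtain x' where x': "x' \<in> closure \<Omega>" "x' \<notin> \<Omega>" "x = a *\<^sub>R x'"
        using x by (auto simp flip: closure_scaleR)
      obtain y' where y': "y' \<in> closure \<Omega>" "y = b *\<^sub>R y'"
        using y by (auto simp flip: closure_scaleR)
      have "x' \<in> frontier \<Omega>" using x' Omega by (simp add: frontier_def interior_open)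
      hence "\<kappa> * t \<le> infdist ((1 + t) *\<^sub>R x') (closure \<Omega>)" using kappa t by blast
      also have "\<dots> \<le> norm ((1 + t) *\<^sub>R x' - y')" using y' infdist_le by (metis dist_norm)
      finally have "b * (\<kappa> * t) \<le> b * norm ((1 + t) *\<^sub>R x' - y')" using ab by simp
      also have "\<dots> = norm (b *\<^sub>R ((1 + t) *\<^sub>R x' - y'))" using ab by simp
      also have "b *\<^sub>R ((1 + t) *\<^sub>R x' - y') = ((1 + t) * (b / a)) *\<^sub>R x - y"
        using ab x' y' by (simp add: scaleR_diff_right mult.commute)
      finally show "b * (\<kappa> * t) \<le> norm (((1 + t) * (b / a)) *\<^sub>R x - y)" .
    next
      fix x p assume x: "x \<in> ?D" and le: "H x p \<le> - \<delta> * u x"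
      have x': "x \<in> closure ?D" using x by (rule subsetD[OF closure_subset])
      \<comment> \<open>Since \<open>u\<close> is also a supersolution, the sublevel set of the
        gradient bound is contained in the one of the uniform level \<open>M\<close>.\<close>
      have "- \<delta> * u x \<le> M"
        by (rule viscosity_supersolution_lower_bound[of \<delta> H ?D])
          (use u bd \<delta> M subsetD[OF DU(2)] x' in \<open>simp_all add: state_constraint_solution_def\<close>)
      thus "norm p \<le> R" using RC(3)[OF subsetD[OF DU(2) x'], of p] le by linarith
    next
      fix x assume "x \<in> ?D" thus "norm x \<le> R0" using DU U by fastforce
    next
      fix x y p q :: 'a assume "x \<in> ?D" "y \<in> closure ?E" "norm p \<le> 2 * R" "norm q \<le> 2 * R"
      thus "H y q - H x p \<le> C * (norm (x - y) + norm (p - q))"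
        using RC(4)[OF subsetD[OF DU(2) subsetD[OF closure_subset]] subsetD[OF EU]] by simp
    next
      show "b *\<^sub>R z \<in> closure ?E" using z by (auto simp flip: closure_scaleR)
      show "a *\<^sub>R ((1 / (1 + t)) *\<^sub>R z) \<in> closure ?D"
        using path[OF t] .
      show "b *\<^sub>R z = ((1 + t) * (b / a)) *\<^sub>R a *\<^sub>R (1 / (1 + t)) *\<^sub>R z" using ab t by simp
    qed (use \<delta> RC in auto)
    have "((\<lambda>t. a *\<^sub>R ((1 / (1 + t)) *\<^sub>R z)) \<longlongrightarrow> a *\<^sub>R ((1 / (1 + 0)) *\<^sub>R z)) (at_right (0::real))"
      by (intro tendsto_intros) auto
    hence "((\<lambda>t. a *\<^sub>R ((1 / (1 + t)) *\<^sub>R z)) \<longlongrightarrow> a *\<^sub>R z) (at_right (0::real))" by simp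
    moreover have "\<forall>\<^sub>F t in at_right (0::real). a *\<^sub>R ((1 / (1 + t)) *\<^sub>R z) \<in> closure ?D"
      using eventually_at_right_less[of "0::real"]
      by eventually_elim (rule path)
    moreover have "a *\<^sub>R z \<in> closure ?D" using z by (auto simp flip: closure_scaleR)
    ultimately have "((\<lambda>t. u (a *\<^sub>R ((1 / (1 + t)) *\<^sub>R z))) \<longlongrightarrow> u (a *\<^sub>R z)) (at_right (0::real))"
      using continuous_on_tendsto_compose[OF cu] by blast
    hence l: "((\<lambda>t. \<delta> * (u (a *\<^sub>R ((1 / (1 + t)) *\<^sub>R z)) - w (b *\<^sub>R z))) \<longlongrightarrow>
        \<delta> * (u (a *\<^sub>R z) - w (b *\<^sub>R z))) (at_right (0::real))"
      by (intro tendsto_intros)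
    have r: "((\<lambda>t. C * (\<bar>(1 + t) * (b / a) - 1\<bar> * (R0 + 2 * R))) \<longlongrightarrow>
        C * (\<bar>(1 + 0) * (b / a) - 1\<bar> * (R0 + 2 * R))) (at_right (0::real))"
      by (intro tendsto_intros)
    have "\<delta> * (u (a *\<^sub>R z) - w (b *\<^sub>R z)) \<le> C * (\<bar>(1 + 0) * (b / a) - 1\<bar> * (R0 + 2 * R))"
      by (rule tendsto_le[OF _ r l])
        (use eventually_mono[OF eventually_at_right_less[of 0] one] in auto)
    thus ?thesis by (simp add: mult_ac)
  qed
  show ?thesis using that[of "C * (R0 + 2 * R)"] est RC \<open>R0 > 0\<close> by simp
qed

text \<open>Rescaling by \<open>k = b / a\<close> turns a subsolution at level \<open>c\<close> into
  one at level \<open>c + L * \<bar>k - 1\<bar>\<close>. The gradient radius behind \<open>L\<close>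
  must not depend on \<open>c\<close>, so only levels up to \<open>M + 1\<close> are moved; these
  suffice, because \<open>M\<close> itself is admissible.\<close>

lemma additive_eigenvalue_scaled_domains:
  obtains L where "L \<ge> 0"
    "\<And>a b. 0 < a \<Longrightarrow> a \<le> 2 \<Longrightarrow> 0 < b \<Longrightarrow> b \<le> 2 \<Longrightarrow> b / a \<ge> 1/2 \<Longrightarrow>
      additive_eigenvalue H ((*\<^sub>R) b ` \<Omega>) \<le> additive_eigenvalue H ((*\<^sub>R) a ` \<Omega>) + L * \<bar>b / a - 1\<bar>"
proof -
  obtain M where M: "\<And>x. x \<in> closure U \<Longrightarrow> H x 0 \<le> M" using H_zero_bounded by metis
  have "compact (closure U)" using U by simp
  then obtain m where m: "\<And>x p. x \<in> closure U \<Longrightarrow> m \<le> H x p"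
    using coercive_bounded_below[OF _ H_cont H_coercive] by metis
  obtain R C where RC: "R > 0" "C \<ge> 0" "\<And>x p. x \<in> closure U \<Longrightarrow> H x p \<le> M + 1 \<Longrightarrow> norm p \<le> R"
    "\<And>x y p q. x \<in> closure U \<Longrightarrow> y \<in> closure U \<Longrightarrow> norm p \<le> 2 * R \<Longrightarrow> norm q \<le> 2 * R \<Longrightarrow>
        H y q - H x p \<le> C * (norm (x - y) + norm (p - q))"
    using sublevel_constants[of "M + 1"] by metis
  have "R0 > 0" using U Omega(3) by force
  define L where "L = C * (R0 + 2 * R)"
  have "additive_eigenvalue H ((*\<^sub>R) b ` \<Omega>) \<le> additive_eigenvalue H ((*\<^sub>R) a ` \<Omega>) + L * \<bar>b / a - 1\<bar>"
    if ab: "0 < a" "a \<le> 2" "0 < b" "b \<le> 2" "b / a \<ge> 1/2" for a b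
  proof -
    define S where "S = (\<lambda>a. {c. \<exists>v. viscosity_subsolution 0 H c ((*\<^sub>R) a ` \<Omega>) v})"
    have ev: "additive_eigenvalue H ((*\<^sub>R) a ` \<Omega>) = Inf (S a)" for a
      by (simp add: additive_eigenvalue_def S_def)
    have sU: "(*\<^sub>R) a ` \<Omega> \<subseteq> closure U" if "0 < a" "a \<le> 2" for a
      by (rule order_trans[OF scale_subset_U closure_subset]) (use that in auto)
    have op: "open ((*\<^sub>R) a ` \<Omega>)" if "0 < a" for a using that Omega by (intro open_scaling) auto
    have MS: "M \<in> S a"
      using viscosity_subsolution_const[OF op[OF ab(1)], of H M] M sU[OF ab(1,2)] unfolding S_def by blast
    have bddS: "bdd_below (S a)" if a: "0 < a" "a \<le> 2" for a
    proof (rule bdd_belowI[of _ m])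
      fix c assume "c \<in> S a"
      then obtain v where v: "viscosity_subsolution 0 H c ((*\<^sub>R) a ` \<Omega>) v" by (auto simp: S_def)
      show "m \<le> c"
        by (rule viscosity_subsolution_level_ge[OF v op]) (use a Omega m sU[OF a] in auto)
    qed
    have key: "Inf (S b) \<le> c + L * \<bar>b / a - 1\<bar>" if c: "c \<in> S a" "c \<le> M + 1" for c
    proof -
      define k where "k = b / a"
      have k: "k > 0" "k \<ge> 1/2" using ab by (auto simp: k_def)
      obtain v where v: "viscosity_subsolution 0 H c ((*\<^sub>R) a ` \<Omega>) v" using c by (auto simp: S_def)
      have "viscosity_subsolution 0 H (c + L * \<bar>k - 1\<bar>) ((*\<^sub>R) k ` (*\<^sub>R) a ` \<Omega>) (\<lambda>y. v ((1 / k) *\<^sub>R y))"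
      proof (rule viscosity_subsolution_rescale[OF v k(1)])
        fix x p assume x: "x \<in> (*\<^sub>R) a ` \<Omega>" and le: "H x (k *\<^sub>R p) \<le> c"
        have xU: "x \<in> closure U" using x sU[OF ab(1,2)] by auto
        have "k *\<^sub>R x \<in> (*\<^sub>R) b ` \<Omega>" using x ab by (auto simp: k_def)
        hence kU: "k *\<^sub>R x \<in> closure U" using sU[OF ab(3,4)] by auto
        have kp: "norm (k *\<^sub>R p) \<le> R" using RC(3)[OF xU, of "k *\<^sub>R p"] le c by linarith
        have p: "norm p \<le> 2 * R"
        proof -
          have "(1/2) * norm p \<le> k * norm p" by (rule mult_right_mono) (use k in auto)
          thus ?thesis using kp k by simp
        qed
        have nx: "norm x \<le> R0" using x scale_subset_U[of a] ab U by fastforce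
        have "H (k *\<^sub>R x) p - H x (k *\<^sub>R p) \<le> C * (norm (x - k *\<^sub>R x) + norm (k *\<^sub>R p - p))"
          using RC(4)[OF xU kU, of "k *\<^sub>R p" p] kp p RC(1) by simp
        also have "norm (x - k *\<^sub>R x) = \<bar>k - 1\<bar> * norm x"
          using norm_scaleR[of "1 - k" x] by (simp add: algebra_simps abs_minus_commute)
        also have "norm (k *\<^sub>R p - p) = \<bar>k - 1\<bar> * norm p"
          using norm_scaleR[of "k - 1" p] by (simp add: algebra_simps)
        also have "C * (\<bar>k - 1\<bar> * norm x + \<bar>k - 1\<bar> * norm p) \<le> C * (\<bar>k - 1\<bar> * R0 + \<bar>k - 1\<bar> * (2 * R))"
          using RC(2) nx p by (intro mult_left_mono add_mono) auto
        also have "\<dots> = L * \<bar>k - 1\<bar>" by (simp add: L_def algebra_simps)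
        finally show "H (k *\<^sub>R x) p \<le> c + L * \<bar>k - 1\<bar>" using le by simp
      qed
      moreover have "(*\<^sub>R) k ` (*\<^sub>R) a ` \<Omega> = (*\<^sub>R) b ` \<Omega>" using ab by (simp add: image_image k_def)
      ultimately have "c + L * \<bar>k - 1\<bar> \<in> S b" by (auto simp: S_def)
      thus ?thesis using cInf_lower[OF _ bddS[OF ab(3,4)]] by (simp add: k_def)
    qed
    have "Inf (S b) \<le> Inf (S a) + L * \<bar>b / a - 1\<bar>"
    proof (rule field_le_epsilon)
      fix e :: real assume "e > 0"
      \<comment> \<open>The cap at 1 keeps the near-optimal level \<open>c\<close> below
        \<open>M + 1\<close>, as \<open>key\<close> demands.\<close>
      hence "Inf (S a) < Inf (S a) + min e 1" by simp
      then obtain c where c: "c \<in> S a" "c < Inf (S a) + min e 1"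
        using cInf_lessD[of "S a"] MS by blast
      have "Inf (S a) \<le> M" using cInf_lower[OF MS bddS[OF ab(1,2)]] .
      thus "Inf (S b) \<le> Inf (S a) + L * \<bar>b / a - 1\<bar> + e" using key[of c] c by linarith
    qed
    thus ?thesis by (simp add: ev)
  qed
  moreover have "L \<ge> 0" using RC \<open>R0 > 0\<close> by (simp add: L_def)
  ultimately show ?thesis using that by blast
qed

end

section \<open>Convergence on the perturbed domains\<close>

theorem theorem1p1:
  fixes \<Omega> U :: "(real ^ 'n) set"
    and R0 \<kappa> :: real
    and H :: "real ^ 'n \<Rightarrow> real ^ 'n \<Rightarrow> real"
    and \<phi> r :: "real \<Rightarrow> real"
    and u v :: "real \<Rightarrow> real ^ 'n \<Rightarrow> real"
    and u0 :: "real ^ 'n \<Rightarrow> real"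
  assumes Omega: "open \<Omega>" "bounded \<Omega>" "connected \<Omega>" "0 \<in> \<Omega>"
    and U: "U = ball 0 R0" "(*\<^sub>R) 2 ` \<Omega> \<subseteq> U"
    and H_cont: "continuous_on (closure U \<times> UNIV) (\<lambda>(x, p). H x p)"
    and phi: "\<forall>l>0. \<phi> l > 0" "continuous_on {0<..} \<phi>" "mono_on {0<..} \<phi>"
      "(\<phi> \<longlongrightarrow> 0) (at_right 0)"
    and r: "continuous_on {0<..} r" "(r \<longlongrightarrow> 0) (at_right 0)"
    and H_Lipschitz: "\<forall>R>0. \<exists>C. \<forall>x\<in>closure U. \<forall>y\<in>closure U. \<forall>p q. norm p \<le> R \<and> norm q \<le> R \<longrightarrow>
      \<bar>H x p - H y p\<bar> \<le> C * norm (x - y) \<and> \<bar>H x p - H x q\<bar> \<le> C * norm (p - q)"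
    and H_coercive: "filterlim (\<lambda>p. INF x\<in>closure U. H x p) at_top at_infinity"
    and H_convex: "\<forall>x\<in>closure U. convex_on UNIV (H x)"
    and star_shaped: "\<forall>x\<in>\<Omega>. closed_segment 0 x \<subseteq> \<Omega>"
    and kappa: "\<kappa> > 0"
      "\<forall>s>0. \<forall>x \<in> (*\<^sub>R) (1 + s) ` frontier \<Omega>. infdist x (closure \<Omega>) \<ge> \<kappa> * s"
    and u: "\<forall>\<^sub>F l in at_right 0. state_constraint_solution (\<phi> l) H 0 ((*\<^sub>R) (1 + r l) ` \<Omega>) (u l)"
    and v: "\<forall>\<delta>>0. state_constraint_solution \<delta> H 0 \<Omega> (v \<delta>)"
    and u0: "continuous_on (closure \<Omega>) u0"
      "uniform_limit (closure \<Omega>) (\<lambda>\<delta> x. v \<delta> x + additive_eigenvalue H \<Omega> / \<delta>) u0 (at_right 0)"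
    and ratio: "((\<lambda>l. r l / \<phi> l) \<longlongrightarrow> 0) (at_right 0)"
  shows "(\<forall>K. compact K \<and> K \<subseteq> \<Omega> \<longrightarrow>
      uniform_limit K (\<lambda>l x. u l x + additive_eigenvalue H \<Omega> / \<phi> l) u0 (at_right 0)) \<and>
    (\<forall>K. compact K \<and> K \<subseteq> \<Omega> \<longrightarrow>
      uniform_limit K (\<lambda>l x. u l x + additive_eigenvalue H ((*\<^sub>R) (1 + r l) ` \<Omega>) / \<phi> l) u0 (at_right 0))"
proof -
  interpret star_shaped_hamiltonian \<Omega> U R0 \<kappa> H
    by (unfold_locales; fact)
  obtain L where L: "L \<ge> 0"
    "\<And>\<delta> a b u w z. \<delta> > 0 \<Longrightarrow> 0 < a \<Longrightarrow> a \<le> 2 \<Longrightarrow> 0 < b \<Longrightarrow> b \<le> 2 \<Longrightarrow> b / a \<ge> 1/2 \<Longrightarrow>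
      state_constraint_solution \<delta> H 0 ((*\<^sub>R) a ` \<Omega>) u \<Longrightarrow>
      state_constraint_solution \<delta> H 0 ((*\<^sub>R) b ` \<Omega>) w \<Longrightarrow> z \<in> closure \<Omega> \<Longrightarrow>
      \<delta> * (u (a *\<^sub>R z) - w (b *\<^sub>R z)) \<le> L * \<bar>b / a - 1\<bar>"
    using comparison_scaled_domains by metis
  obtain L' where L': "L' \<ge> 0"
    "\<And>a b. 0 < a \<Longrightarrow> a \<le> 2 \<Longrightarrow> 0 < b \<Longrightarrow> b \<le> 2 \<Longrightarrow> b / a \<ge> 1/2 \<Longrightarrow>
      additive_eigenvalue H ((*\<^sub>R) b ` \<Omega>) \<le> additive_eigenvalue H ((*\<^sub>R) a ` \<Omega>) + L' * \<bar>b / a - 1\<bar>"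
    using additive_eigenvalue_scaled_domains by metis
  have Omega1: "(*\<^sub>R) 1 ` \<Omega> = \<Omega>" by simp
  have phi_pos: "\<forall>\<^sub>F l in at_right 0. \<phi> l > 0"
    using eventually_at_right_less[of "0::real"] by eventually_elim (use phi in auto)
  have r_small: "\<forall>\<^sub>F l in at_right 0. \<bar>r l\<bar> < e" if "e > 0" for e
    using tendstoD[OF r(2) that] by simp
  have r_half: "\<forall>\<^sub>F l in at_right 0. \<bar>r l\<bar> < 1/2" by (rule r_small) simp
  have inv_bound: "\<bar>1 / (1 + \<rho>) - 1\<bar> \<le> 2 * \<bar>\<rho>\<bar>" if "\<bar>\<rho>\<bar> < 1/2" for \<rho> :: real
  proof -
    have "1 / (1 + \<rho>) - 1 = - \<rho> / (1 + \<rho>)" using that by (simp add: field_simps)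
    moreover have "\<bar>\<rho>\<bar> / (1 + \<rho>) \<le> \<bar>\<rho>\<bar> / (1/2)" using that by (intro divide_left_mono) auto
    ultimately show ?thesis using that by (simp add: abs_divide)
  qed
  \<comment> \<open>The assumption on \<open>r l / \<phi> l\<close> enters here. The factor 2 covers
    both scale ratios, \<open>1 + r l\<close> and its inverse, by \<open>inv_bound\<close>;
    \<open>k\<close> will be \<open>L\<close> or \<open>L'\<close>.\<close>
  have ratio_small: "\<forall>\<^sub>F l in at_right 0. k * (2 * \<bar>r l\<bar>) / \<phi> l < e" if "e > 0" for e k :: real
  proof -
    have "((\<lambda>l. k * (2 * \<bar>r l / \<phi> l\<bar>)) \<longlongrightarrow> k * (2 * \<bar>0\<bar>)) (at_right 0)"
      by (intro tendsto_intros ratio)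
    hence "\<forall>\<^sub>F l in at_right 0. k * (2 * \<bar>r l / \<phi> l\<bar>) < e"
      using that by (simp add: order_tendsto_iff)
    thus ?thesis using phi_pos by eventually_elim (simp add: abs_divide)
  qed
  \<comment> \<open>Both functions carry the discount \<open>\<phi> l\<close>, so the comparison
    applies in either direction, and dividing by \<open>\<phi> l\<close> leaves an error of order
    \<open>\<bar>r l\<bar> / \<phi> l\<close>, uniform up to the boundary.\<close>
  have comp: "\<forall>\<^sub>F l in at_right 0. \<forall>z\<in>closure \<Omega>. \<bar>u l ((1 + r l) *\<^sub>R z) - v (\<phi> l) z\<bar> < e"
    if "e > 0" for e
    using u phi_pos r_half ratio_small[OF that, of L]
  proof eventually_elim
    case (elim l)
    have s: "1 + r l > 0" "1 + r l \<le> 2" "1 / (1 + r l) \<ge> 1/2" "1 + r l \<ge> 1/2"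
      using elim by (auto simp: field_simps)
    have ib: "\<bar>1 / (1 + r l) - 1\<bar> \<le> 2 * \<bar>r l\<bar>" using inv_bound elim by blast
    have vl: "state_constraint_solution (\<phi> l) H 0 ((*\<^sub>R) 1 ` \<Omega>) (v (\<phi> l))"
      using v elim by (simp add: Omega1)
    show ?case
    proof
      fix z assume z: "z \<in> closure \<Omega>"
      have "\<phi> l * (u l ((1 + r l) *\<^sub>R z) - v (\<phi> l) (1 *\<^sub>R z)) \<le> L * \<bar>1 / (1 + r l) - 1\<bar>"
        using L(2)[OF _ _ _ _ _ _ _ vl z] elim s by simp
      also have "\<dots> \<le> L * (2 * \<bar>r l\<bar>)" using ib L(1) by (rule mult_left_mono)
      finally have 1: "\<phi> l * (u l ((1 + r l) *\<^sub>R z) - v (\<phi> l) z) \<le> L * (2 * \<bar>r l\<bar>)" by simp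
      have "\<phi> l * (v (\<phi> l) (1 *\<^sub>R z) - u l ((1 + r l) *\<^sub>R z)) \<le> L * \<bar>(1 + r l) / 1 - 1\<bar>"
        by (rule L(2)[OF _ _ _ _ _ _ vl _ z]) (use elim s in auto)
      also have "\<dots> \<le> L * (2 * \<bar>r l\<bar>)" using L(1) by (intro mult_left_mono) auto
      finally have 2: "\<phi> l * (v (\<phi> l) z - u l ((1 + r l) *\<^sub>R z)) \<le> L * (2 * \<bar>r l\<bar>)" by simp
      have "\<bar>u l ((1 + r l) *\<^sub>R z) - v (\<phi> l) z\<bar> \<le> L * (2 * \<bar>r l\<bar>) / \<phi> l"
        using 1 2 elim by (simp add: abs_le_iff pos_le_divide_eq mult.commute)
      thus "\<bar>u l ((1 + r l) *\<^sub>R z) - v (\<phi> l) z\<bar> < e" using elim by linarith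
    qed
  qed
  have eig: "((\<lambda>l. (additive_eigenvalue H ((*\<^sub>R) (1 + r l) ` \<Omega>) - additive_eigenvalue H \<Omega>) / \<phi> l)
      \<longlongrightarrow> 0) (at_right 0)"
  proof (rule tendstoI)
    fix e :: real assume e: "e > 0"
    show "\<forall>\<^sub>F l in at_right 0.
        dist ((additive_eigenvalue H ((*\<^sub>R) (1 + r l) ` \<Omega>) - additive_eigenvalue H \<Omega>) / \<phi> l) 0 < e"
      using phi_pos r_half ratio_small[OF e, of L']
    proof eventually_elim
      case (elim l)
      have s: "1 + r l > 0" "1 + r l \<le> 2" "1 / (1 + r l) \<ge> 1/2" "1 + r l \<ge> 1/2"
        using elim by (auto simp: field_simps)
      have ib: "L' * \<bar>1 / (1 + r l) - 1\<bar> \<le> L' * (2 * \<bar>r l\<bar>)"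
        using inv_bound elim L'(1) by (intro mult_left_mono) auto
      have ib2: "L' * \<bar>r l\<bar> \<le> L' * (2 * \<bar>r l\<bar>)" using L'(1) by (intro mult_left_mono) auto
      let ?c = "additive_eigenvalue H ((*\<^sub>R) (1 + r l) ` \<Omega>)" and ?b = "additive_eigenvalue H \<Omega>"
      have "?b \<le> ?c + L' * \<bar>1 / (1 + r l) - 1\<bar>"
        by (rule L'(2)[of "1 + r l" 1, unfolded Omega1]) (use s in auto)
      moreover have "?c \<le> ?b + L' * \<bar>(1 + r l) / 1 - 1\<bar>"
        by (rule L'(2)[of 1 "1 + r l", unfolded Omega1]) (use s in auto)
      ultimately have "\<bar>?c - ?b\<bar> \<le> L' * (2 * \<bar>r l\<bar>)" using ib ib2 by simp
      hence "\<bar>?c - ?b\<bar> / \<phi> l \<le> L' * (2 * \<bar>r l\<bar>) / \<phi> l" using elim by (intro divide_right_mono) auto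
      thus ?case using elim by (simp add: abs_divide)
    qed
  qed
  \<comment> \<open>With \<open>z\<close> the preimage of \<open>x\<close> under the scaling, three
    errors are added: \<open>u l x\<close> against \<open>v (\<phi> l) z\<close>, the normalized
    \<open>v (\<phi> l) z\<close> against \<open>u0 z\<close>, and \<open>u0 z\<close> against
    \<open>u0 x\<close>.\<close>
  have main: "uniform_limit K (\<lambda>l x. u l x + additive_eigenvalue H \<Omega> / \<phi> l) u0 (at_right 0)"
    if K: "compact K" "K \<subseteq> \<Omega>" for K
  proof (rule uniform_limitI)
    fix e :: real assume e: "e > 0"
    have "compact (closure \<Omega>)" using Omega by simp
    hence "uniformly_continuous_on (closure \<Omega>) u0" using u0(1) compact_uniformly_continuous by blast
    then obtain d where d: "d > 0" "\<And>x y. x \<in> closure \<Omega> \<Longrightarrow> y \<in> closure \<Omega> \<Longrightarrow> dist y x < d \<Longrightarrow>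
        dist (u0 y) (u0 x) < e / 3"
      using e unfolding uniformly_continuous_on_def by (metis divide_pos_pos zero_less_numeral)
    obtain d' where d': "d' > 0" "(\<Union>x\<in>K. ball x d') \<subseteq> \<Omega>"
      using compact_subset_open_imp_ball_epsilon_subset[OF K(1) Omega(1) K(2)] by metis
    obtain B where B: "B > 0" "\<And>x. x \<in> K \<Longrightarrow> norm x \<le> B"
      using compact_imp_bounded[OF K(1)] by (auto simp: bounded_pos)
    \<comment> \<open>The bound 1/2 admits \<open>inv_bound\<close>, and the other one gives
      \<open>dist z x < min d d'\<close>: \<open>d\<close> serves the uniform continuity of
      \<open>u0\<close>, and \<open>d'\<close> keeps \<open>z\<close> in
      \<open>\<Omega>\<close>.\<close>
    define \<eta> where "\<eta> = min (1/2) (min d d' / (2 * B))"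
    have \<eta>: "\<eta> > 0" using d d' B by (simp add: \<eta>_def)
    \<comment> \<open>Since \<open>\<phi>\<close> tends to 0 through positive values, the limit in
      the discount may be evaluated along \<open>\<phi> l\<close>.\<close>
    have lim_phi: "filterlim \<phi> (at_right 0) (at_right 0)"
      using phi(4) phi_pos by (auto simp: filterlim_at elim: eventually_mono)
    have "\<forall>\<^sub>F \<delta> in at_right 0. \<forall>x\<in>closure \<Omega>. dist (v \<delta> x + additive_eigenvalue H \<Omega> / \<delta>) (u0 x) < e / 3"
      using uniform_limitD[OF u0(2), of "e / 3"] e by simp
    hence ev: "\<forall>\<^sub>F l in at_right 0. \<forall>x\<in>closure \<Omega>.
        dist (v (\<phi> l) x + additive_eigenvalue H \<Omega> / \<phi> l) (u0 x) < e / 3"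
      using lim_phi by (rule eventually_compose_filterlim)
    have e3: "e / 3 > 0" using e by simp
    show "\<forall>\<^sub>F l in at_right 0. \<forall>x\<in>K. dist (u l x + additive_eigenvalue H \<Omega> / \<phi> l) (u0 x) < e"
      using ev comp[OF e3] r_small[OF \<eta>]
    proof eventually_elim
      case (elim l)
      have rl: "\<bar>r l\<bar> < 1/2" "2 * B * \<bar>r l\<bar> < min d d'"
        using elim(3) B by (auto simp: \<eta>_def field_simps)
      show ?case
      proof
        fix x assume x: "x \<in> K"
        define z where "z = (1 / (1 + r l)) *\<^sub>R x"
        have xz: "x = (1 + r l) *\<^sub>R z" using rl by (simp add: z_def)
        have "z - x = (1 / (1 + r l) - 1) *\<^sub>R x" by (simp add: z_def algebra_simps)
        hence "norm (z - x) = \<bar>1 / (1 + r l) - 1\<bar> * norm x" by simp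
        also have "\<dots> \<le> (2 * \<bar>r l\<bar>) * B" using inv_bound[OF rl(1)] B x by (intro mult_mono) auto
        finally have zx: "dist z x < min d d'" using rl(2) by (simp add: dist_norm mult_ac)
        hence "z \<in> ball x d'" by (simp add: dist_commute)
        hence "z \<in> \<Omega>" using d'(2) x by blast
        hence z: "z \<in> closure \<Omega>" by (rule subsetD[OF closure_subset])
        have x': "x \<in> closure \<Omega>" using subsetD[OF K(2) x] by (rule subsetD[OF closure_subset])
        have "dist (u0 z) (u0 x) < e / 3" using d(2)[OF x' z] zx by simp
        moreover have "dist (v (\<phi> l) z + additive_eigenvalue H \<Omega> / \<phi> l) (u0 z) < e / 3"
          using elim z by blast
        moreover have "\<bar>u l x - v (\<phi> l) z\<bar> < e / 3" using elim z xz by metis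
        ultimately show "dist (u l x + additive_eigenvalue H \<Omega> / \<phi> l) (u0 x) < e"
          unfolding dist_real_def by linarith
      qed
    qed
  qed
  \<comment> \<open>The two normalizations differ by a quantity constant in \<open>x\<close> that
    tends to 0 by \<open>eig\<close>.\<close>
  have main': "uniform_limit K (\<lambda>l x. u l x + additive_eigenvalue H ((*\<^sub>R) (1 + r l) ` \<Omega>) / \<phi> l) u0 (at_right 0)"
    if K: "compact K" "K \<subseteq> \<Omega>" for K
  proof -
    have "uniform_limit K (\<lambda>l x. (additive_eigenvalue H ((*\<^sub>R) (1 + r l) ` \<Omega>) - additive_eigenvalue H \<Omega>) / \<phi> l)
        (\<lambda>_. 0) (at_right 0)"
      using tendstoD[OF eig] by (intro uniform_limitI) (auto elim: eventually_mono)
    from uniform_limit_add[OF main[OF K] this] show ?thesis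
      by (simp add: diff_divide_distrib)
  qed
  show ?thesis using main main' by blast
qed

end
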